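(* Let $d,n\ge1$ and for each $m=1,\dots,n$ let $\{U^{(m)}_s\}_{s=1}^{d^2}$ be a unitary error basis on $\mathbb{C}^d$. Let $V_m:\mathbb{C}^d\otimes\mathbb{C}^d\to\mathbb{C}^{d^2}$ be the unitary map with $\langle s|V_m|x,y\rangle=\frac1{\sqrt d}(U^{(m)}_s)_{x,y}$, let $\eta=\frac1{\sqrt d}\sum_{j=0}^{d-1}|j\rangle\otimes|j\rangle\in\mathbb{C}^d\otimes\mathbb{C}^d$, and let $\Delta_n:\mathbb{C}^{d^2}\to(\mathbb{C}^{d^2})^{\otimes n}$ be the linear map $|s\rangle\mapsto|s\rangle^{\otimes n}$. Then the isometry $$i=(\Delta_nV_1\otimes\Delta_nV_2\otimes\cdots\otimes\Delta_nV_n)\circ\big(\mathrm{id}_{\mathbb{C}^d}\otimes\eta^{\otimes(n-1)}\otimes\mathrm{id}_{\mathbb{C}^d}\big):\ \mathbb{C}^d\otimes\mathbb{C}^d\to(\mathbb{C}^{d^2})^{\otimes n^2}$$ (where the $2n$ tensor factors $\mathbb{C}^d$ are grouped into consecutive pairs, the $m$-th pair being the input of $V_m$) gives an $[[n^2,1,n]]^{U(d^2)}_{d^2}$ code with logical qudit $\mathbb{C}^d\otimes\mathbb{C}^d\cong\mathbb{C}^{d^2}$; that is, for every $(n,U(d^2))$-local operator $e$ on $(\mathbb{C}^{d^2})^{\otimes n^2}$ the composite $i^\dagger\circ e\circ i$ is proportional to the identity.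
   Context: A unitary error basis on a finite-dimensional Hilbert space $K$ is a basis of the space of operators on $K$ consisting of unitary operators $U_s$ with $\mathrm{Tr}(U_s^\dagger U_t)=\delta_{s,t}\dim K$. For a subgroup $\mathcal E\subseteq U(D)$, an operator $e$ on $(\mathbb{C}^{D})^{\otimes N}$ is $(p,\mathcal E)$-local when $e=W_1\otimes\cdots\otimes W_N$ with all $W_i\in\mathcal E$ and at most $p-1$ of the $W_i$ different from the identity. By the Knill–Laflamme theorem, an isometry $i:(\mathbb{C}^D)^{\otimes k}\to(\mathbb{C}^D)^{\otimes N}$ gives an $[[N,k,p]]^{\mathcal E}_D$ code exactly when $i^\dagger\circ e\circ i$ is proportional to the identity (any factor allowed, including $0$) for every $(p,\mathcal E)$-local $e$; this is taken as the criterion here. *)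

theory Defs
  imports "Jordan_Normal_Form.VS_Connect"
begin

text \<open>
  Operators \<open>\<complex>\<^sup>a \<rightarrow> \<complex>\<^sup>b\<close> are \<open>b \<times> a\<close> matrices with respect to the computational bases, and
  \<open>\<complex>\<^sup>a \<otimes> \<complex>\<^sup>b\<close> is \<open>\<complex>\<^bsup>a b\<^esup>\<close> with \<open>|x\<rangle> \<otimes> |y\<rangle> = |x b + y\<rangle>\<close>. With this convention the
  Kronecker product is strictly associative and unital, so regrouping tensor factors needs no
  explicit isomorphism. All families and basis vectors are indexed from 0.
\<close>

definition kron :: "complex mat \<Rightarrow> complex mat \<Rightarrow> complex mat" (infixr \<open>\<otimes>\<^sub>m\<close> 75) where
  "A \<otimes>\<^sub>m B = mat (dim_row A * dim_row B) (dim_col A * dim_col B)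
     (\<lambda>(i, j). A $$ (i div dim_row B, j div dim_col B) * B $$ (i mod dim_row B, j mod dim_col B))"

definition kron_list :: "complex mat list \<Rightarrow> complex mat" where
  "kron_list As = foldr kron As (1\<^sub>m 1)"

definition kron_pow :: "nat \<Rightarrow> complex mat \<Rightarrow> complex mat" where
  "kron_pow n A = kron_list (replicate n A)"

text \<open>
  The constant \<open>mat_adjoint\<close> of \<open>Jordan_Normal_Form.Schur_Decomposition\<close> is the adjoint only for
  square matrices, whereas here adjoints of isometries are needed.
\<close>

definition dagger :: "complex mat \<Rightarrow> complex mat" where
  "dagger A = transpose_mat (map_mat cnj A)"

definition mat_trace :: "complex mat \<Rightarrow> complex" where
  "mat_trace A = (\<Sum>i<dim_row A. A $$ (i, i))"

definition unitary_group :: "nat \<Rightarrow> complex mat set" where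
  "unitary_group D = {W \<in> carrier_mat D D. dagger W * W = 1\<^sub>m D \<and> W * dagger W = 1\<^sub>m D}"

definition unitary_error_basis :: "nat \<Rightarrow> (nat \<Rightarrow> complex mat) \<Rightarrow> bool" where
  "unitary_error_basis d U \<longleftrightarrow>
     inj_on U {..<d\<^sup>2} \<and>
     vectorspace.basis class_ring (module_mat TYPE(complex) d d) (U ` {..<d\<^sup>2}) \<and>
     (\<forall>s<d\<^sup>2. U s \<in> unitary_group d) \<and>
     (\<forall>s<d\<^sup>2. \<forall>t<d\<^sup>2. mat_trace (dagger (U s) * U t) = (if s = t then of_nat d else 0))"

definition local_operator :: "nat \<Rightarrow> nat \<Rightarrow> nat \<Rightarrow> complex mat set \<Rightarrow> complex mat \<Rightarrow> bool" where
  "local_operator D N p E e \<longleftrightarrow>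
     (\<exists>Ws. length Ws = N \<and> set Ws \<subseteq> E \<and> card {i. i < N \<and> Ws ! i \<noteq> 1\<^sub>m D} < p \<and>
           e = kron_list Ws)"

definition is_code ::
  "nat \<Rightarrow> nat \<Rightarrow> nat \<Rightarrow> nat \<Rightarrow> complex mat set \<Rightarrow> complex mat \<Rightarrow> bool" where
  "is_code D N k p E i \<longleftrightarrow>
     i \<in> carrier_mat (D ^ N) (D ^ k) \<and> dagger i * i = 1\<^sub>m (D ^ k) \<and>
     (\<forall>e. local_operator D N p E e \<longrightarrow> (\<exists>c. dagger i * e * i = c \<cdot>\<^sub>m 1\<^sub>m (D ^ k)))"

definition ket :: "nat \<Rightarrow> nat \<Rightarrow> complex mat" where
  "ket D j = mat D 1 (\<lambda>(i, _). if i = j then 1 else 0)"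

definition ueb_map :: "nat \<Rightarrow> (nat \<Rightarrow> complex mat) \<Rightarrow> complex mat" where
  "ueb_map d U = mat (d\<^sup>2) (d * d)
     (\<lambda>(s, k). complex_of_real (1 / sqrt d) * U s $$ (k div d, k mod d))"

definition eta :: "nat \<Rightarrow> complex mat" where
  "eta d = complex_of_real (1 / sqrt d) \<cdot>\<^sub>m
     mat (d * d) 1 (\<lambda>ab. \<Sum>j<d. (ket d j \<otimes>\<^sub>m ket d j) $$ ab)"

definition copy_map :: "nat \<Rightarrow> nat \<Rightarrow> complex mat" where
  "copy_map n D = mat (D ^ n) D (\<lambda>(r, s). kron_pow n (ket D s) $$ (r, 0))"

definition code_isometry :: "nat \<Rightarrow> nat \<Rightarrow> (nat \<Rightarrow> nat \<Rightarrow> complex mat) \<Rightarrow> complex mat" where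
  "code_isometry d n U =
     kron_list (map (\<lambda>m. copy_map n (d\<^sup>2) * ueb_map d (U m)) [0..<n]) *
     (1\<^sub>m d \<otimes>\<^sub>m kron_pow (n - 1) (eta d) \<otimes>\<^sub>m 1\<^sub>m d)"

end

theory Submission
  imports Defs
begin

text \<open>
  Conjugating \<open>n\<close> tensor factors by the copy map gives the entrywise product of the factors, which
  is diagonal as soon as one of them is the identity; by pigeonhole this happens in each of the
  \<open>n\<close> blocks, and one block carries no error at all. Since the \<open>U\<^sub>s\<close> are unitary, conjugating a
  diagonal operator by the unitary of an error basis gives an operator \<open>A\<^sub>m\<close> on
  \<open>\<complex>\<^sup>d \<otimes> \<complex>\<^sup>d\<close> both of whose partial traces are scalar. Contracting neighbouring \<open>A\<^sub>m\<close> along the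
  maximally entangled states \<open>\<eta>\<close> preserves this property, and contracting such an operator with a
  scalar one only sees its partial trace, so the error-free block makes the whole contraction scalar.
\<close>

section \<open>Mixed-radix indices and finite sums\<close>

lemma div_less_factor: "i div b < a" if "i < a * b" for i a b :: nat
  using that by (simp add: less_mult_imp_div_less)

lemma mod_less_factor: "i mod b < b" if "i < a * b" for i a b :: nat
  using that by (cases "b = 0") auto

lemma mult_add_less: "i * b + j < a * b" if "i < a" "j < b" for i j a b :: nat
proof -
  have "i * b + j < Suc i * b" using that by simp
  also have "\<dots> \<le> a * b" using that by (intro mult_le_mono1) simp
  finally show ?thesis .
qed

lemma sum_lessThan_mult:
  "(\<Sum>i<a * b. f i) = (\<Sum>i<a. \<Sum>j<b. f (i * b + j))" for f :: "nat \<Rightarrow> 'a :: comm_monoid_add"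
proof (induction a)
  case (Suc a)
  have "(\<Sum>i<p + b. f i) = (\<Sum>i<p. f i) + (\<Sum>j<b. f (p + j))" for p
    by (induction b) (simp_all add: add.assoc)
  from this[of "a * b"] show ?case using Suc by (simp add: add.commute)
qed simp

text \<open>Used to move the sum of a partial trace past the two contraction indices of
  \<open>index_glue_pair\<close>.\<close>

lemma sum_swap3:
  "(\<Sum>i\<in>A. \<Sum>j\<in>B. \<Sum>k\<in>C. f i j k) = (\<Sum>j\<in>B. \<Sum>k\<in>C. \<Sum>i\<in>A. f i j k)"
  for f :: "'a \<Rightarrow> 'b \<Rightarrow> 'c \<Rightarrow> 'd :: comm_monoid_add"
  by (subst sum.swap) (intro sum.cong refl sum.swap)

lemma index_mult_mat_sum:
  "(A * B) $$ (i, j) = (\<Sum>k<dim_row B. A $$ (i, k) * B $$ (k, j))"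
  if "i < dim_row A" "j < dim_col B" "dim_col A = dim_row B"
  using that by (simp add: scalar_prod_def lessThan_atLeast0)

section \<open>Kronecker products and adjoints\<close>

lemma dim_kron [simp]:
  "dim_row (A \<otimes>\<^sub>m B) = dim_row A * dim_row B" "dim_col (A \<otimes>\<^sub>m B) = dim_col A * dim_col B"
  by (simp_all add: kron_def)

lemma kron_carrier_mat [simp]:
  "A \<otimes>\<^sub>m B \<in> carrier_mat (a * c) (b * d)" if "A \<in> carrier_mat a b" "B \<in> carrier_mat c d"
  using that by (intro carrier_matI) auto

lemma index_kron:
  "(A \<otimes>\<^sub>m B) $$ (i, j) = A $$ (i div dim_row B, j div dim_col B) * B $$ (i mod dim_row B, j mod dim_col B)"
  if "i < dim_row A * dim_row B" "j < dim_col A * dim_col B"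
  using that by (simp add: kron_def)

lemma dim_dagger [simp]: "dim_row (dagger A) = dim_col A" "dim_col (dagger A) = dim_row A"
  by (simp_all add: dagger_def)

lemma index_dagger: "dagger A $$ (i, j) = cnj (A $$ (j, i))" if "i < dim_col A" "j < dim_row A"
  using that by (simp add: dagger_def)

lemma dagger_mult: "dagger (A * B) = dagger B * dagger A" if "dim_col A = dim_row B"
  by (rule eq_matI)
    (use that in \<open>auto simp: index_dagger index_mult_mat_sum mult.commute simp del: index_mult_mat(1)\<close>)

lemma dagger_kron: "dagger (A \<otimes>\<^sub>m B) = dagger A \<otimes>\<^sub>m dagger B"
  by (rule eq_matI) (auto simp: index_dagger index_kron div_less_factor mod_less_factor)

lemma dagger_one [simp]: "dagger (1\<^sub>m k) = 1\<^sub>m k"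
  by (rule eq_matI) (auto simp: index_dagger)

text \<open>Either bracketing reads the same three mixed-radix digits off a row or column index, so
  the equality holds entrywise without any reindexing.\<close>

lemma kron_assoc: "(A \<otimes>\<^sub>m B) \<otimes>\<^sub>m C = A \<otimes>\<^sub>m (B \<otimes>\<^sub>m C)"
proof (rule eq_matI)
  have split: "i div c < a * b" "i mod (b * c) < b * c" if "i < a * (b * c)" for i a b c :: nat
    using that div_less_factor[of i "a * b" c] mod_less_factor[of i a "b * c"]
    by (simp_all add: mult.assoc)
  have digits: "i mod (b * c) div c = i div c mod b" "i mod (b * c) mod c = i mod c"
    "i div (b * c) = i div c div b" for i b c :: nat
    by (cases "c = 0"; simp add: mod_mult2_eq div_mult2_eq mult.commute[of b c])+
  fix i j assume "i < dim_row (A \<otimes>\<^sub>m (B \<otimes>\<^sub>m C))" "j < dim_col (A \<otimes>\<^sub>m (B \<otimes>\<^sub>m C))"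
  then have i: "i < dim_row A * (dim_row B * dim_row C)" and j: "j < dim_col A * (dim_col B * dim_col C)"
    by simp_all
  show "((A \<otimes>\<^sub>m B) \<otimes>\<^sub>m C) $$ (i, j) = (A \<otimes>\<^sub>m (B \<otimes>\<^sub>m C)) $$ (i, j)"
    using i j split[OF i] split[OF j] by (simp add: index_kron mult.assoc digits)
qed (simp_all add: mult.assoc)

lemma one_kron [simp]: "1\<^sub>m 1 \<otimes>\<^sub>m A = A"
  by (rule eq_matI) (simp_all add: index_kron)

lemma kron_one [simp]: "A \<otimes>\<^sub>m 1\<^sub>m 1 = A"
  by (rule eq_matI) (simp_all add: index_kron)

lemma one_kron_one: "1\<^sub>m a \<otimes>\<^sub>m 1\<^sub>m b = 1\<^sub>m (a * b)"
proof (rule eq_matI)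
  fix i j assume "i < dim_row (1\<^sub>m (a * b) :: complex mat)" "j < dim_col (1\<^sub>m (a * b) :: complex mat)"
  then have ij: "i < a * b" "j < a * b" by simp_all
  have "i = j" if "i div b = j div b" "i mod b = j mod b" using that by (metis div_mult_mod_eq)
  then show "(1\<^sub>m a \<otimes>\<^sub>m 1\<^sub>m b) $$ (i, j) = 1\<^sub>m (a * b) $$ (i, j)"
    using ij by (auto simp: index_kron div_less_factor mod_less_factor)
qed simp_all

text \<open>Mixed-product property: the inner summation index splits into its two digits, and the
  resulting double sum factors into a product of two sums.\<close>

lemma kron_mult:
  assumes "dim_col A = dim_row C" "dim_col B = dim_row D"
  shows "(A \<otimes>\<^sub>m B) * (C \<otimes>\<^sub>m D) = (A * C) \<otimes>\<^sub>m (B * D)"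
proof (rule eq_matI)
  fix i j assume "i < dim_row ((A * C) \<otimes>\<^sub>m (B * D))" "j < dim_col ((A * C) \<otimes>\<^sub>m (B * D))"
  then have i: "i < dim_row A * dim_row B" and j: "j < dim_col C * dim_col D" by simp_all
  note b = div_less_factor[OF i] mod_less_factor[OF i] div_less_factor[OF j] mod_less_factor[OF j]
  have "((A \<otimes>\<^sub>m B) * (C \<otimes>\<^sub>m D)) $$ (i, j)
      = (\<Sum>k<dim_row C * dim_row D. (A \<otimes>\<^sub>m B) $$ (i, k) * (C \<otimes>\<^sub>m D) $$ (k, j))"
    using i j assms by (subst index_mult_mat_sum) simp_all
  also have "\<dots> = (\<Sum>k<dim_row C. \<Sum>l<dim_row D.
      (A $$ (i div dim_row B, k) * C $$ (k, j div dim_col D)) *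
      (B $$ (i mod dim_row B, l) * D $$ (l, j mod dim_col D)))"
    unfolding sum_lessThan_mult
    by (intro sum.cong refl) (use i j assms in \<open>simp add: index_kron mult_add_less\<close>)
  also have "\<dots> = (A * C) $$ (i div dim_row B, j div dim_col D) * (B * D) $$ (i mod dim_row B, j mod dim_col D)"
    using b assms by (simp add: index_mult_mat_sum sum_product del: index_mult_mat(1))
  also have "\<dots> = ((A * C) \<otimes>\<^sub>m (B * D)) $$ (i, j)"
    using i j by (subst index_kron) simp_all
  finally show "((A \<otimes>\<^sub>m B) * (C \<otimes>\<^sub>m D)) $$ (i, j) = ((A * C) \<otimes>\<^sub>m (B * D)) $$ (i, j)" .
qed simp_all

section \<open>Tensor products of lists and conjugation\<close>

lemma kron_list_simps [simp]:
  "kron_list [] = 1\<^sub>m 1" "kron_list (A # As) = A \<otimes>\<^sub>m kron_list As"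
  by (simp_all add: kron_list_def)

lemma kron_list_append: "kron_list (As @ Bs) = kron_list As \<otimes>\<^sub>m kron_list Bs"
  by (induction As) (simp_all add: kron_assoc del: One_nat_def)

lemma kron_list_mult:
  "kron_list (map (\<lambda>x. f x * g x) xs) = kron_list (map f xs) * kron_list (map g xs)"
  if "\<And>x. x \<in> set xs \<Longrightarrow> dim_col (f x) = dim_row (g x)"
proof -
  \<comment> \<open>The matching inner dimensions of the two long products are carried through the
    induction, because \<open>kron_mult\<close> requires them for the tails.\<close>
  have "dim_col (kron_list (map f xs)) = dim_row (kron_list (map g xs)) \<and> ?thesis"
    using that by (induction xs) (simp_all add: kron_mult)
  then show ?thesis ..
qed

lemma dagger_kron_list: "dagger (kron_list As) = kron_list (map dagger As)"
  by (induction As) (simp_all add: dagger_kron del: One_nat_def)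

lemma kron_list_carrier_mat:
  assumes "\<And>x. x \<in> set xs \<Longrightarrow> f x \<in> carrier_mat a b"
  shows "kron_list (map f xs) \<in> carrier_mat (a ^ length xs) (b ^ length xs)"
  using assms by (induction xs) auto

lemma kron_list_one: "kron_list (replicate k (1\<^sub>m D)) = 1\<^sub>m (D ^ k)"
  by (induction k) (simp_all add: one_kron_one)

text \<open>The number \<open>k\<close> of blocks is kept apart from the block length
  \<open>n\<close>, so that induction can add one block at a time while the length stays fixed. The
  code uses \<open>k = n\<close>.\<close>

lemma kron_list_blocks:
  "kron_list (map f [0..<k * n]) = kron_list (map (\<lambda>m. kron_list (map (\<lambda>j. f (m * n + j)) [0..<n])) [0..<k])"
proof (induction k)
  case (Suc k)
  have "map (\<lambda>j. k * n + j) [0..<n] = [k * n..<k * n + n]"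
    by (rule nth_equalityI) simp_all
  then have "[0..<Suc k * n] = [0..<k * n] @ map (\<lambda>j. k * n + j) [0..<n]"
    using upt_add_eq_append[of 0 "k * n" n] by (simp add: add.commute)
  then show ?case using Suc by (simp add: kron_list_append comp_def del: One_nat_def)
qed simp

lemma index_kron_list_scalar:
  assumes "\<And>A. A \<in> set As \<Longrightarrow> A \<in> carrier_mat 1 1"
  shows "kron_list As \<in> carrier_mat 1 1 \<and> kron_list As $$ (0, 0) = (\<Prod>A\<leftarrow>As. A $$ (0, 0))"
  using assms
proof (induction As)
  case (Cons A As)
  then have A: "A \<in> carrier_mat 1 1" and As: "kron_list As \<in> carrier_mat 1 1" by auto
  then have "dim_row A = 1" "dim_col A = 1" "dim_row (kron_list As) = 1" "dim_col (kron_list As) = 1"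
    by blast+
  then show ?case using Cons kron_carrier_mat[OF A As] by (simp add: index_kron)
qed simp


text \<open>Conjugation by a composite is a conjugation inside a conjugation; this is the
  associativity step that peels off the outer layer.\<close>

lemma mult_mat_regroup:
  assumes P: "P \<in> carrier_mat a b" and Q: "Q \<in> carrier_mat b c" and M: "M \<in> carrier_mat c e"
    and R: "R \<in> carrier_mat e f" and S: "S \<in> carrier_mat f g"
  shows "(P * Q) * M * (R * S) = P * (Q * M * R) * S"
proof -
  have QM: "Q * M \<in> carrier_mat b e" and RS: "R * S \<in> carrier_mat e g" and QMR: "Q * M * R \<in> carrier_mat b f"
    using Q M R S by auto
  have "(P * Q) * M * (R * S) = P * ((Q * M) * (R * S))"
    unfolding assoc_mult_mat[OF P Q M] by (rule assoc_mult_mat[OF P QM RS])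
  also have "\<dots> = P * ((Q * M * R) * S)" by (simp only: assoc_mult_mat[OF QM R S])
  also have "\<dots> = P * (Q * M * R) * S" by (rule assoc_mult_mat[OF P QMR S, symmetric])
  finally show ?thesis .
qed

text \<open>\<open>J\<close> and \<open>K\<close> may differ, so that matrix elements between two
  different vectors are covered as well as conjugation by a single map.\<close>

lemma index_conjugate:
  assumes "i < dim_col J" "j < dim_col K" "dim_row M = dim_row J" "dim_col M = dim_row K"
  shows "(dagger J * M * K) $$ (i, j)
    = (\<Sum>r<dim_row J. \<Sum>t<dim_row K. cnj (J $$ (r, i)) * M $$ (r, t) * K $$ (t, j))"
proof -
  have "(dagger J * M * K) $$ (i, j)
      = (\<Sum>t<dim_row K. (\<Sum>r<dim_row J. cnj (J $$ (r, i)) * M $$ (r, t)) * K $$ (t, j))"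
    using assms by (simp add: index_mult_mat_sum index_dagger del: index_mult_mat(1))
  also have "\<dots> = (\<Sum>t<dim_row K. \<Sum>r<dim_row J. cnj (J $$ (r, i)) * M $$ (r, t) * K $$ (t, j))"
    by (simp add: sum_distrib_right)
  also have "\<dots> = (\<Sum>r<dim_row J. \<Sum>t<dim_row K. cnj (J $$ (r, i)) * M $$ (r, t) * K $$ (t, j))"
    by (rule sum.swap)
  finally show ?thesis .
qed

section \<open>Basis vectors and the copy map\<close>

lemma ket_carrier_mat [simp]: "ket D s \<in> carrier_mat D 1"
  by (simp add: ket_def)

lemma dim_ket [simp]: "dim_row (ket D s) = D" "dim_col (ket D s) = 1"
  by (simp_all add: ket_def)

lemma index_ket_conjugate:
  assumes "W \<in> carrier_mat D D" "s < D" "t < D"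
  shows "(dagger (ket D s) * W * ket D t) $$ (0, 0) = W $$ (s, t)"
proof -
  have "(dagger (ket D s) * W * ket D t) $$ (0, 0)
      = (\<Sum>r<D. \<Sum>k<D. (if r = s then 1 else 0) * W $$ (r, k) * (if k = t then 1 else 0))"
    using assms by (subst index_conjugate) (auto simp: ket_def intro!: sum.cong)
  also have "\<dots> = W $$ (s, t)"
    using assms by (simp add: if_distrib[of "\<lambda>z. z * _"] if_distrib[of "\<lambda>z. _ * z"] cong: if_cong)
  finally show ?thesis .
qed

lemma copy_map_carrier_mat [simp]: "copy_map n D \<in> carrier_mat (D ^ n) D"
  by (simp add: copy_map_def)

lemma dim_copy_map [simp]: "dim_row (copy_map n D) = D ^ n" "dim_col (copy_map n D) = D"
  by (simp_all add: copy_map_def)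

text \<open>Column \<open>s\<close> of the copy map is the product vector
  \<open>kron_pow n (ket D s)\<close>. A matrix element of a tensor product between two product
  vectors is the product of the single-factor matrix elements, which gives the entrywise (Hadamard)
  product of the factors.\<close>

lemma index_copy_map_conjugate:
  assumes "set Ws \<subseteq> carrier_mat D D" "s < D" "t < D"
  shows "(dagger (copy_map (length Ws) D) * kron_list Ws * copy_map (length Ws) D) $$ (s, t)
    = (\<Prod>W\<leftarrow>Ws. W $$ (s, t))"
proof -
  define n where "n = length Ws"
  have pow: "kron_pow n (ket D u) = kron_list (map (\<lambda>W. ket D u) Ws)" for u
    by (simp add: kron_pow_def n_def map_replicate_const)
  have pow_dim: "kron_pow n (ket D u) \<in> carrier_mat (D ^ n) 1" for u
    unfolding pow using kron_list_carrier_mat[of Ws "\<lambda>W. ket D u" D 1] by (simp add: n_def del: One_nat_def)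
  have M: "kron_list Ws \<in> carrier_mat (D ^ n) (D ^ n)"
    using kron_list_carrier_mat[of Ws id D D] assms(1) by (auto simp: n_def)
  have "(dagger (copy_map n D) * kron_list Ws * copy_map n D) $$ (s, t)
      = (dagger (kron_pow n (ket D s)) * kron_list Ws * kron_pow n (ket D t)) $$ (0, 0)"
    using assms M pow_dim[of s] pow_dim[of t]
    by (subst (1 2) index_conjugate) (auto simp: copy_map_def intro!: sum.cong)
  also have "dagger (kron_pow n (ket D s)) * kron_list Ws * kron_pow n (ket D t)
      = kron_list (map (\<lambda>W. dagger (ket D s) * W * ket D t) Ws)"
    using assms(1) by (subst kron_list_mult, force, subst kron_list_mult)
      (auto simp: pow dagger_kron_list comp_def)
  also have "\<dots> $$ (0, 0) = (\<Prod>W\<leftarrow>Ws. (dagger (ket D s) * W * ket D t) $$ (0, 0))"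
    by (subst index_kron_list_scalar[THEN conjunct2]) (auto simp: comp_def intro!: carrier_matI)
  also have "\<dots> = (\<Prod>W\<leftarrow>Ws. W $$ (s, t))"
    using assms by (intro arg_cong[where f = prod_list] map_cong refl index_ket_conjugate) auto
  finally show ?thesis by (simp add: n_def)
qed

section \<open>Contraction along one maximally entangled state\<close>

definition bell_insertion :: "nat \<Rightarrow> complex mat" where
  "bell_insertion d = 1\<^sub>m d \<otimes>\<^sub>m eta d \<otimes>\<^sub>m 1\<^sub>m d"

text \<open>
  The maximally entangled state connects the second factor of \<open>A\<close> to the first factor of \<open>B\<close>.
\<close>

definition glue :: "nat \<Rightarrow> complex mat \<Rightarrow> complex mat \<Rightarrow> complex mat" where
  "glue d A B = dagger (bell_insertion d) * (A \<otimes>\<^sub>m B) * bell_insertion d"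

lemma eta_carrier_mat [simp]: "eta d \<in> carrier_mat (d * d) 1"
  by (simp add: eta_def)

lemma dim_eta [simp]: "dim_row (eta d) = d * d" "dim_col (eta d) = 1"
  using eta_carrier_mat[of d] by (auto simp del: eta_carrier_mat)

lemma dim_bell_insertion [simp]:
  "dim_row (bell_insertion d) = d * d * (d * d)" "dim_col (bell_insertion d) = d * d"
  by (simp_all add: bell_insertion_def mult.assoc)

lemma index_eta:
  assumes "p < d * d"
  shows "eta d $$ (p, 0) = complex_of_real (1 / sqrt d) * (\<Sum>j<d. if p = j * d + j then 1 else 0)"
proof -
  have "(ket d j \<otimes>\<^sub>m ket d j) $$ (p, 0) = (if p = j * d + j then 1 else 0)" if "j < d" for j
  proof -
    have "p div d = j \<and> p mod d = j \<longleftrightarrow> p = j * d + j"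
    proof
      assume "p div d = j \<and> p mod d = j"
      then show "p = j * d + j" by (metis div_mult_mod_eq)
    qed (use that in simp)
    then show ?thesis
      using assms that by (auto simp: kron_def ket_def div_less_factor mod_less_factor)
  qed
  then show ?thesis using assms by (simp add: eta_def)
qed

text \<open>The basis vector with digits \<open>x\<close>, \<open>y\<close> goes to the normalized
  sum over \<open>j\<close> of the vectors with digits \<open>x\<close>, \<open>j\<close>,
  \<open>j\<close>, \<open>y\<close>. The row index is written as the pair \<open>x\<close>,
  \<open>j\<close> followed by the pair \<open>j\<close>, \<open>y\<close>, since this is the
  grouping seen by \<open>A\<close> and \<open>B\<close> in \<open>glue\<close>.\<close>

lemma index_bell_insertion:
  assumes "r < d * d * (d * d)" "c < d * d"
  shows "bell_insertion d $$ (r, c) = complex_of_real (1 / sqrt d) *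
    (\<Sum>j<d. if r = (c div d * d + j) * (d * d) + (j * d + c mod d) then 1 else 0)"
proof -
  define x y p where "x = c div d" and "y = c mod d" and "p = r mod (d * d * d)"
  have d: "d > 0" using assms by (cases d) auto
  have x: "x < d" and y: "y < d"
    using assms(2) div_less_factor mod_less_factor unfolding x_def y_def by blast+
  have r: "r < d * (d * d * d)" using assms(1) by (simp add: mult.assoc)
  have p: "p < d * d * d" using d by (simp add: p_def)
  note rb = div_less_factor[OF r] and pb = div_less_factor[OF p] mod_less_factor[OF p]
  \<comment> \<open>The Kronecker structure of \<open>bell_insertion\<close> groups the four digits
    as 1 + 2 + 1; this converts that grouping to 2 + 2.\<close>
  have digits: "(r div (d * d * d) = x \<and> p div d = j * d + j \<and> p mod d = y)
      \<longleftrightarrow> r = (x * d + j) * (d * d) + (j * d + y)" if j: "j < d" for j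
  proof
    assume "r div (d * d * d) = x \<and> p div d = j * d + j \<and> p mod d = y"
    then have "r = x * (d * d * d) + p" "p = (j * d + j) * d + y"
      using div_mult_mod_eq[of r "d * d * d"] div_mult_mod_eq[of p d] by (simp_all add: p_def)
    then show "r = (x * d + j) * (d * d) + (j * d + y)" by (simp add: algebra_simps)
  next
    assume "r = (x * d + j) * (d * d) + (j * d + y)"
    then have req: "r = ((j * d + j) * d + y) + x * (d * d * d)" by (simp add: algebra_simps)
    have "(j * d + j) * d + y < d * d * d" using j y by (intro mult_add_less)
    then have "r div (d * d * d) = x" "p = y + (j * d + j) * d"
      unfolding p_def req using d by simp_all
    then show "r div (d * d * d) = x \<and> p div d = j * d + j \<and> p mod d = y"
      using y by (simp del: add_mult_distrib)
  qed
  have "bell_insertion d $$ (r, c) =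
      (if r div (d * d * d) = x then 1 else 0) * (eta d $$ (p div d, 0) * (if p mod d = y then 1 else 0))"
    using assms r rb x y p pb
    by (simp add: bell_insertion_def index_kron x_def[symmetric] y_def[symmetric] p_def[symmetric])
  also have "\<dots> = complex_of_real (1 / sqrt d) * (\<Sum>j<d. if r div (d * d * d) = x \<and> p div d = j * d + j \<and> p mod d = y
      then 1 else 0)"
    using pb by (simp add: index_eta)
  also have "\<dots> = complex_of_real (1 / sqrt d) * (\<Sum>j<d. if r = (x * d + j) * (d * d) + (j * d + y) then 1 else 0)"
    using digits by simp
  finally show ?thesis by (simp only: x_def y_def)
qed

lemma of_real_inverse_sqrt_square:
  "complex_of_real (1 / sqrt (real d)) * complex_of_real (1 / sqrt (real d)) = 1 / of_nat d"
  by (simp flip: of_real_mult)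

text \<open>The entangled state makes the second digit of \<open>A\<close> agree with the first
  digit of \<open>B\<close>, separately on the bra side (value \<open>j\<close>) and on the ket side
  (value \<open>k\<close>). The two normalization factors combine to
  \<open>1 / of_nat d\<close>.\<close>

lemma index_glue:
  assumes A: "A \<in> carrier_mat (d * d) (d * d)" and B: "B \<in> carrier_mat (d * d) (d * d)"
    and c: "c < d * d" and c': "c' < d * d"
  shows "glue d A B $$ (c, c') = 1 / of_nat d * (\<Sum>j<d. \<Sum>k<d.
    A $$ (c div d * d + j, c' div d * d + k) * B $$ (j * d + c mod d, k * d + c' mod d))"
proof -
  define \<rho> where "\<rho> c j = (c div d * d + j) * (d * d) + (j * d + c mod d)" for c j
  define \<alpha> where "\<alpha> = complex_of_real (1 / sqrt d)"
  let ?N = "d * d * (d * d)"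
  have \<rho>: "\<rho> c j < ?N" if "c < d * d" "j < d" for c j
    unfolding \<rho>_def using that by (intro mult_add_less div_less_factor mod_less_factor)
  \<comment> \<open>Summing against the coefficients of column \<open>c\<close> visits only the
    \<open>d\<close> rows \<open>\<rho> c j\<close>.\<close>
  have pick: "(\<Sum>r<?N. (\<Sum>j<d. if r = \<rho> c j then 1 else 0) * f r) = (\<Sum>j<d. f (\<rho> c j))"
    if "c < d * d" for c and f :: "nat \<Rightarrow> complex"
    unfolding sum_distrib_right by (subst sum.swap) (use \<rho>[OF that] in
      \<open>auto simp: if_distrib[of "\<lambda>z. z * _"] cong: if_cong intro!: sum.cong\<close>)
  have J: "bell_insertion d $$ (r, c) = \<alpha> * (\<Sum>j<d. if r = \<rho> c j then 1 else 0)"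
    if "r < ?N" "c < d * d" for r c
    using index_bell_insertion[OF that] by (simp add: \<rho>_def \<alpha>_def)
  \<comment> \<open>The coefficients are real, so bra and ket can be treated by the same indicator
    sum.\<close>
  have real: "cnj (\<alpha> * (\<Sum>j<d. if r = \<rho> c j then 1 else 0)) = \<alpha> * (\<Sum>j<d. if r = \<rho> c j then 1 else 0)"
    for r c
    by (simp add: \<alpha>_def if_distrib[of cnj] cong: if_cong)
  have "glue d A B $$ (c, c') = (\<Sum>r<?N. \<Sum>t<?N.
      cnj (bell_insertion d $$ (r, c)) * (A \<otimes>\<^sub>m B) $$ (r, t) * bell_insertion d $$ (t, c'))"
    unfolding glue_def using assms by (subst index_conjugate) auto
  also have "\<dots> = (\<Sum>r<?N. \<Sum>t<?N. \<alpha> * \<alpha> * ((\<Sum>j<d. if r = \<rho> c j then 1 else 0) *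
      ((\<Sum>k<d. if t = \<rho> c' k then 1 else 0) * (A \<otimes>\<^sub>m B) $$ (r, t))))"
    by (intro sum.cong refl) (use c c' in \<open>simp only: lessThan_iff J real mult_ac\<close>)
  also have "\<dots> = \<alpha> * \<alpha> * (\<Sum>r<?N. (\<Sum>j<d. if r = \<rho> c j then 1 else 0) *
      (\<Sum>t<?N. (\<Sum>k<d. if t = \<rho> c' k then 1 else 0) * (A \<otimes>\<^sub>m B) $$ (r, t)))"
    by (simp only: sum_distrib_left)
  also have "\<dots> = \<alpha> * \<alpha> * (\<Sum>j<d. \<Sum>k<d. (A \<otimes>\<^sub>m B) $$ (\<rho> c j, \<rho> c' k))"
    using c c' by (simp only: pick)
  also have "\<dots> = 1 / of_nat d * (\<Sum>j<d. \<Sum>k<d.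
      A $$ (c div d * d + j, c' div d * d + k) * B $$ (j * d + c mod d, k * d + c' mod d))"
  proof -
    have low: "j * d + c mod d < d * d" if "c < d * d" "j < d" for c j
      using that by (intro mult_add_less mod_less_factor)
    \<comment> \<open>In base \<open>d * d\<close>, the high digit of \<open>\<rho> c j\<close>
      indexes \<open>A\<close> and the low digit indexes \<open>B\<close>.\<close>
    have split: "\<rho> c j div (d * d) = c div d * d + j" "\<rho> c j mod (d * d) = j * d + c mod d"
      if "c < d * d" "j < d" for c j
      using low[OF that] that unfolding \<rho>_def by simp_all
    show ?thesis
      unfolding \<alpha>_def of_real_inverse_sqrt_square
      by (intro arg_cong[where f = "\<lambda>z. _ * z"] sum.cong refl)
        (use A B \<rho>[OF c] \<rho>[OF c'] in \<open>simp add: index_kron split c c'\<close>)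
  qed
  finally show ?thesis .
qed

section \<open>Operators with scalar partial traces\<close>

text \<open>The two sums are the partial traces of an operator on two qudits: the first traces out
  the second qudit, the second traces out the first. Both are required to be scalar.\<close>

definition balanced :: "nat \<Rightarrow> complex mat \<Rightarrow> bool" where
  "balanced d A \<longleftrightarrow> A \<in> carrier_mat (d * d) (d * d) \<and>
    (\<exists>a. \<forall>x<d. \<forall>x'<d. (\<Sum>y<d. A $$ (x * d + y, x' * d + y)) = (if x = x' then a else 0)) \<and>
    (\<exists>b. \<forall>y<d. \<forall>y'<d. (\<Sum>x<d. A $$ (x * d + y, x * d + y')) = (if y = y' then b else 0))"

lemma index_scalar_pair:
  fixes b :: complex
  assumes "x < d" "y < d" "x' < d" "y' < d"
  shows "(b \<cdot>\<^sub>m 1\<^sub>m (d * d)) $$ (x * d + y, x' * d + y') = (if x = x' \<and> y = y' then b else 0)"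
proof -
  have "x = x' \<and> y = y'" if "x * d + y = x' * d + y'"
    using arg_cong[OF that, of "\<lambda>z. z div d"] arg_cong[OF that, of "\<lambda>z. z mod d"] assms by simp
  then show ?thesis using assms by (auto simp: mult_add_less)
qed

lemma eq_mat_pairI:
  assumes "A \<in> carrier_mat (d * d) (d * d)" "B \<in> carrier_mat (d * d) (d * d)"
    and "\<And>x y x' y'. \<lbrakk>x < d; y < d; x' < d; y' < d\<rbrakk> \<Longrightarrow> A $$ (x * d + y, x' * d + y') = B $$ (x * d + y, x' * d + y')"
  shows "A = B"
proof (rule eq_matI)
  fix i j assume "i < dim_row B" "j < dim_col B"
  then have "i < d * d" "j < d * d" using assms(2) by auto
  then show "A $$ (i, j) = B $$ (i, j)"
    using assms(3)[of "i div d" "i mod d" "j div d" "j mod d"]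
    by (simp add: div_less_factor mod_less_factor)
qed (use assms in auto)

lemma glue_carrier_mat [simp]: "glue d A B \<in> carrier_mat (d * d) (d * d)"
  by (intro carrier_matI) (simp_all add: glue_def)

lemma index_glue_pair:
  assumes "A \<in> carrier_mat (d * d) (d * d)" "B \<in> carrier_mat (d * d) (d * d)"
    and "x < d" "y < d" "x' < d" "y' < d"
  shows "glue d A B $$ (x * d + y, x' * d + y') =
    1 / of_nat d * (\<Sum>j<d. \<Sum>k<d. A $$ (x * d + j, x' * d + k) * B $$ (j * d + y, k * d + y'))"
  using assms by (subst index_glue) (auto simp: mult_add_less)

text \<open>Tracing out the right qudit of the result involves only \<open>B\<close>. It yields a
  scalar times the indicator of \<open>j = k\<close>, which closes the remaining contraction into a
  partial trace of \<open>A\<close>. The other partial trace is the mirror image.\<close>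

lemma balanced_glue:
  assumes "balanced d A" "balanced d B"
  shows "balanced d (glue d A B)"
proof -
  have A: "A \<in> carrier_mat (d * d) (d * d)" and B: "B \<in> carrier_mat (d * d) (d * d)"
    using assms by (auto simp: balanced_def)
  note glue = index_glue_pair[OF A B]
  obtain a1 where a1: "\<And>x x'. \<lbrakk>x < d; x' < d\<rbrakk> \<Longrightarrow> (\<Sum>y<d. A $$ (x * d + y, x' * d + y)) = (if x = x' then a1 else 0)"
    using assms(1) unfolding balanced_def by blast
  obtain a2 where a2: "\<And>y y'. \<lbrakk>y < d; y' < d\<rbrakk> \<Longrightarrow> (\<Sum>x<d. A $$ (x * d + y, x * d + y')) = (if y = y' then a2 else 0)"
    using assms(1) unfolding balanced_def by blast
  obtain b1 where b1: "\<And>x x'. \<lbrakk>x < d; x' < d\<rbrakk> \<Longrightarrow> (\<Sum>y<d. B $$ (x * d + y, x' * d + y)) = (if x = x' then b1 else 0)"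
    using assms(2) unfolding balanced_def by blast
  obtain b2 where b2: "\<And>y y'. \<lbrakk>y < d; y' < d\<rbrakk> \<Longrightarrow> (\<Sum>x<d. B $$ (x * d + y, x * d + y')) = (if y = y' then b2 else 0)"
    using assms(2) unfolding balanced_def by blast
  have "(\<Sum>y<d. glue d A B $$ (x * d + y, x' * d + y)) = (if x = x' then 1 / of_nat d * (a1 * b1) else 0)"
    if x: "x < d" "x' < d" for x x'
  proof -
    have "(\<Sum>y<d. glue d A B $$ (x * d + y, x' * d + y))
        = 1 / of_nat d * (\<Sum>y<d. \<Sum>j<d. \<Sum>k<d. A $$ (x * d + j, x' * d + k) * B $$ (j * d + y, k * d + y))"
      using x by (simp add: glue sum_distrib_left)
    also have "(\<Sum>y<d. \<Sum>j<d. \<Sum>k<d. A $$ (x * d + j, x' * d + k) * B $$ (j * d + y, k * d + y))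
        = (\<Sum>j<d. \<Sum>k<d. A $$ (x * d + j, x' * d + k) * (\<Sum>y<d. B $$ (j * d + y, k * d + y)))"
      by (subst sum_swap3) (simp only: sum_distrib_left)
    also have "\<dots> = (\<Sum>j<d. A $$ (x * d + j, x' * d + j)) * b1"
      by (simp add: b1 if_distrib[of "\<lambda>z. _ * z"] sum_distrib_right cong: if_cong)
    finally show ?thesis using x by (simp add: a1)
  qed
  moreover have "(\<Sum>x<d. glue d A B $$ (x * d + y, x * d + y')) = (if y = y' then 1 / of_nat d * (a2 * b2) else 0)"
    if y: "y < d" "y' < d" for y y'
  proof -
    have "(\<Sum>x<d. glue d A B $$ (x * d + y, x * d + y'))
        = 1 / of_nat d * (\<Sum>x<d. \<Sum>j<d. \<Sum>k<d. A $$ (x * d + j, x * d + k) * B $$ (j * d + y, k * d + y'))"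
      using y by (simp add: glue sum_distrib_left)
    also have "(\<Sum>x<d. \<Sum>j<d. \<Sum>k<d. A $$ (x * d + j, x * d + k) * B $$ (j * d + y, k * d + y'))
        = (\<Sum>j<d. \<Sum>k<d. (\<Sum>x<d. A $$ (x * d + j, x * d + k)) * B $$ (j * d + y, k * d + y'))"
      by (subst sum_swap3) (simp only: sum_distrib_right)
    also have "\<dots> = a2 * (\<Sum>j<d. B $$ (j * d + y, j * d + y'))"
      by (simp add: a2 if_distrib[of "\<lambda>z. z * _"] sum_distrib_left cong: if_cong)
    finally show ?thesis using y by (simp add: b2)
  qed
  ultimately show ?thesis unfolding balanced_def by (auto intro!: exI)
qed

text \<open>A scalar right operand forces \<open>j = k\<close> in the contraction, so only the
  partial trace of \<open>A\<close> over its second qudit survives.\<close>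

lemma glue_scalar_right:
  assumes A: "A \<in> carrier_mat (d * d) (d * d)"
    and a: "\<And>x x'. \<lbrakk>x < d; x' < d\<rbrakk> \<Longrightarrow> (\<Sum>y<d. A $$ (x * d + y, x' * d + y)) = (if x = x' then a else 0)"
  shows "glue d A (b \<cdot>\<^sub>m 1\<^sub>m (d * d)) = (a * b / of_nat d) \<cdot>\<^sub>m 1\<^sub>m (d * d)"
proof (rule eq_mat_pairI[where d = d])
  fix x y x' y' assume xy: "x < d" "y < d" "x' < d" "y' < d"
  have "glue d A (b \<cdot>\<^sub>m 1\<^sub>m (d * d)) $$ (x * d + y, x' * d + y')
      = 1 / of_nat d * (\<Sum>j<d. \<Sum>k<d. A $$ (x * d + j, x' * d + k) * (if j = k \<and> y = y' then b else 0))"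
    using xy A by (subst index_glue_pair) (simp_all add: index_scalar_pair)
  also have "\<dots> = (if y = y' then 1 / of_nat d * ((\<Sum>j<d. A $$ (x * d + j, x' * d + j)) * b) else 0)"
    by (simp add: if_distrib[of "\<lambda>z. _ * z"] sum_distrib_right cong: if_cong)
  finally show "glue d A (b \<cdot>\<^sub>m 1\<^sub>m (d * d)) $$ (x * d + y, x' * d + y')
      = ((a * b / of_nat d) \<cdot>\<^sub>m 1\<^sub>m (d * d)) $$ (x * d + y, x' * d + y')"
    using xy by (simp add: a index_scalar_pair)
qed simp_all

text \<open>Mirror image of \<open>glue_scalar_right\<close>: the scalar left operand leaves the
  partial trace of \<open>B\<close> over its first qudit.\<close>

lemma glue_scalar_left:
  assumes B: "B \<in> carrier_mat (d * d) (d * d)"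
    and b: "\<And>y y'. \<lbrakk>y < d; y' < d\<rbrakk> \<Longrightarrow> (\<Sum>x<d. B $$ (x * d + y, x * d + y')) = (if y = y' then b else 0)"
  shows "glue d (a \<cdot>\<^sub>m 1\<^sub>m (d * d)) B = (a * b / of_nat d) \<cdot>\<^sub>m 1\<^sub>m (d * d)"
proof (rule eq_mat_pairI[where d = d])
  fix x y x' y' assume xy: "x < d" "y < d" "x' < d" "y' < d"
  have "glue d (a \<cdot>\<^sub>m 1\<^sub>m (d * d)) B $$ (x * d + y, x' * d + y')
      = 1 / of_nat d * (\<Sum>j<d. \<Sum>k<d. (if x = x' \<and> j = k then a else 0) * B $$ (j * d + y, k * d + y'))"
    using xy B by (subst index_glue_pair) (simp_all add: index_scalar_pair)
  also have "\<dots> = (if x = x' then 1 / of_nat d * (\<Sum>j<d. a * B $$ (j * d + y, j * d + y')) else 0)"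
    by (simp add: if_distrib[of "\<lambda>z. z * _"] cong: if_cong)
  finally show "glue d (a \<cdot>\<^sub>m 1\<^sub>m (d * d)) B $$ (x * d + y, x' * d + y')
      = ((a * b / of_nat d) \<cdot>\<^sub>m 1\<^sub>m (d * d)) $$ (x * d + y, x' * d + y')"
    using xy by (simp add: b index_scalar_pair flip: sum_distrib_left)
qed simp_all

text \<open>The partial trace \<open>d\<close> of the identity cancels the normalization
  \<open>1 / of_nat d\<close>; equivalently, \<open>bell_insertion d\<close> is an isometry.\<close>

lemma glue_one_one: "glue d (1\<^sub>m (d * d)) (1\<^sub>m (d * d)) = 1\<^sub>m (d * d)" if "d > 0"
proof -
  have one: "1 \<cdot>\<^sub>m 1\<^sub>m (d * d) = (1\<^sub>m (d * d) :: complex mat)" by (rule eq_matI) auto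
  have "(\<Sum>y<d. 1\<^sub>m (d * d) $$ (x * d + y, x' * d + y)) = (if x = x' then of_nat d else 0 :: complex)"
    if "x < d" "x' < d" for x x'
    using that by (subst one[symmetric]) (simp add: index_scalar_pair del: index_smult_mat(1))
  from glue_scalar_right[OF one_carrier_mat this, of 1] show ?thesis using that by (simp add: one)
qed

section \<open>Contraction of a chain of operators\<close>

definition ancilla :: "nat \<Rightarrow> nat \<Rightarrow> complex mat" where
  "ancilla d k = 1\<^sub>m d \<otimes>\<^sub>m kron_pow k (eta d) \<otimes>\<^sub>m 1\<^sub>m d"

text \<open>Intended for lists of \<open>k + 1\<close> operators on consecutive pairs of qudits:
  each of the \<open>k\<close> entangled states then links two neighbours in the list.\<close>

definition contract :: "nat \<Rightarrow> nat \<Rightarrow> complex mat list \<Rightarrow> complex mat" where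
  "contract d k As = dagger (ancilla d k) * kron_list As * ancilla d k"

lemma kron_pow_eta_carrier_mat: "kron_pow k (eta d) \<in> carrier_mat ((d * d) ^ k) 1"
  using kron_list_carrier_mat[of "replicate k ()" "\<lambda>_. eta d" "d * d" 1]
  by (simp add: kron_pow_def del: One_nat_def)

lemma dim_ancilla [simp]:
  "dim_row (ancilla d k) = (d * d) ^ Suc k" "dim_col (ancilla d k) = d * d"
  using kron_pow_eta_carrier_mat[of k d] by (auto simp: ancilla_def)

lemma ancilla_carrier_mat: "ancilla d k \<in> carrier_mat ((d * d) ^ Suc k) (d * d)"
  by (intro carrier_matI) simp_all

lemma ancilla_0: "ancilla d 0 = 1\<^sub>m (d * d)"
  by (simp add: ancilla_def kron_pow_def one_kron_one del: One_nat_def)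

text \<open>The leftmost entangled pair is created first, and the other \<open>k\<close> are then
  inserted inside the right-hand pair of qudits. This makes a chain accessible to induction from its
  head.\<close>

lemma ancilla_Suc: "ancilla d (Suc k) = (1\<^sub>m (d * d) \<otimes>\<^sub>m ancilla d k) * bell_insertion d"
proof -
  define H where "H = kron_pow k (eta d) \<otimes>\<^sub>m 1\<^sub>m d"
  have H: "dim_col H = d" using kron_pow_eta_carrier_mat[of k d] by (auto simp: H_def)
  \<comment> \<open>The identity on three qudits is regrouped from 2 + 1 to 1 + 2, so that its
    two-qudit part lines up with \<open>eta d\<close>.\<close>
  have "1\<^sub>m (d * d) \<otimes>\<^sub>m ancilla d k = 1\<^sub>m d \<otimes>\<^sub>m (1\<^sub>m (d * d) \<otimes>\<^sub>m H)"
    unfolding ancilla_def H_def[symmetric]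
    by (simp only: kron_assoc[symmetric] one_kron_one mult.assoc)
  then have "(1\<^sub>m (d * d) \<otimes>\<^sub>m ancilla d k) * bell_insertion d
      = (1\<^sub>m d \<otimes>\<^sub>m (1\<^sub>m (d * d) \<otimes>\<^sub>m H)) * (1\<^sub>m d \<otimes>\<^sub>m (eta d \<otimes>\<^sub>m 1\<^sub>m d))"
    by (simp add: bell_insertion_def)
  also have "\<dots> = 1\<^sub>m d \<otimes>\<^sub>m ((1\<^sub>m (d * d) * eta d) \<otimes>\<^sub>m (H * 1\<^sub>m d))"
    using H by (simp add: kron_mult)
  also have "\<dots> = 1\<^sub>m d \<otimes>\<^sub>m (eta d \<otimes>\<^sub>m H)"
    using H by (simp add: left_mult_one_mat' right_mult_one_mat')
  also have "\<dots> = ancilla d (Suc k)"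
    by (simp add: ancilla_def H_def kron_pow_def kron_assoc)
  finally show ?thesis ..
qed

text \<open>By \<open>ancilla_Suc\<close>, the inner conjugation leaves \<open>A\<close> alone and
  contracts the tail, while the outer one is the gluing of the two.\<close>

lemma contract_Cons:
  assumes A: "A \<in> carrier_mat (d * d) (d * d)"
    and As: "kron_list As \<in> carrier_mat ((d * d) ^ Suc k) ((d * d) ^ Suc k)"
  shows "contract d (Suc k) (A # As) = glue d A (contract d k As)"
proof -
  let ?I = "1\<^sub>m (d * d) :: complex mat" and ?J = "bell_insertion d" and ?E = "ancilla d k" and ?K = "kron_list As"
  have J: "?J \<in> carrier_mat (d * d * (d * d)) (d * d)" and E: "?E \<in> carrier_mat ((d * d) ^ Suc k) (d * d)"
    by (auto intro: carrier_matI)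
  have IE: "?I \<otimes>\<^sub>m ?E \<in> carrier_mat (d * d * (d * d) ^ Suc k) (d * d * (d * d))"
    and AK: "A \<otimes>\<^sub>m ?K \<in> carrier_mat (d * d * (d * d) ^ Suc k) (d * d * (d * d) ^ Suc k)"
    using A As E by (auto intro: kron_carrier_mat simp del: power_Suc)
  have dag: "dagger X \<in> carrier_mat b a" if "X \<in> carrier_mat a b" for X a b
    using that by (intro carrier_matI) auto
  have "contract d (Suc k) (A # As) = (dagger ?J * dagger (?I \<otimes>\<^sub>m ?E)) * (A \<otimes>\<^sub>m ?K) * ((?I \<otimes>\<^sub>m ?E) * ?J)"
    unfolding contract_def ancilla_Suc using IE J by (subst dagger_mult) auto
  also have "\<dots> = dagger ?J * (dagger (?I \<otimes>\<^sub>m ?E) * (A \<otimes>\<^sub>m ?K) * (?I \<otimes>\<^sub>m ?E)) * ?J"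
    by (rule mult_mat_regroup[OF dag[OF J] dag[OF IE] AK IE J])
  also have "dagger (?I \<otimes>\<^sub>m ?E) * (A \<otimes>\<^sub>m ?K) * (?I \<otimes>\<^sub>m ?E) = (?I * A * ?I) \<otimes>\<^sub>m contract d k As"
    using A As E by (simp add: dagger_kron kron_mult contract_def)
  also have "?I * A * ?I = A" using A by simp
  finally show ?thesis by (simp add: glue_def)
qed

lemma contract_singleton: "contract d 0 [A] = A" if "A \<in> carrier_mat (d * d) (d * d)"
  using that by (simp add: contract_def ancilla_0 del: One_nat_def)

lemma balanced_carrier_mat: "A \<in> carrier_mat (d * d) (d * d)" if "balanced d A"
  using that by (simp add: balanced_def)

lemma one_smult_one_mat: "(1 :: complex) \<cdot>\<^sub>m 1\<^sub>m k = 1\<^sub>m k"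
  by (rule eq_matI) auto

text \<open>Both claims go through one induction. If the head is the identity, the balanced tail is
  glued to a scalar; otherwise the identity lies in the tail, which is scalar by induction, and the
  balanced head is glued to it.\<close>

lemma contract_balanced:
  assumes "length As = Suc k" "\<And>A. A \<in> set As \<Longrightarrow> balanced d A"
  shows "balanced d (contract d k As) \<and>
    (1\<^sub>m (d * d) \<in> set As \<longrightarrow> (\<exists>c. contract d k As = c \<cdot>\<^sub>m 1\<^sub>m (d * d)))"
  using assms
proof (induction k arbitrary: As)
  case 0
  then obtain A where "As = [A]" by (auto simp: length_Suc_conv)
  with 0 show ?case
    by (auto simp: contract_singleton balanced_carrier_mat intro!: exI[of _ 1] one_smult_one_mat[symmetric])
next
  case (Suc k)
  then obtain A Bs where As: "As = A # Bs" and len: "length Bs = Suc k" by (auto simp: length_Suc_conv)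
  let ?B = "contract d k Bs"
  have A: "balanced d A" and Bs: "\<And>B. B \<in> set Bs \<Longrightarrow> balanced d B"
    using Suc.prems As by auto
  note IH = Suc.IH[OF len Bs]
  have "kron_list Bs \<in> carrier_mat ((d * d) ^ Suc k) ((d * d) ^ Suc k)"
    using kron_list_carrier_mat[of Bs id "d * d" "d * d"] Bs balanced_carrier_mat len by auto
  then have step: "contract d (Suc k) As = glue d A ?B"
    unfolding As using A by (intro contract_Cons balanced_carrier_mat)
  have "\<exists>c. glue d A ?B = c \<cdot>\<^sub>m 1\<^sub>m (d * d)" if "1\<^sub>m (d * d) \<in> set As"
  proof (cases "A = 1\<^sub>m (d * d)")
    case True
    then have A1: "A = 1 \<cdot>\<^sub>m 1\<^sub>m (d * d)" by (simp add: one_smult_one_mat)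
    obtain b where b: "\<And>y y'. \<lbrakk>y < d; y' < d\<rbrakk> \<Longrightarrow>
        (\<Sum>x<d. ?B $$ (x * d + y, x * d + y')) = (if y = y' then b else 0)"
      using IH unfolding balanced_def by blast
    have "?B \<in> carrier_mat (d * d) (d * d)" using IH balanced_carrier_mat by blast
    from glue_scalar_left[OF this b, of 1] show ?thesis unfolding A1 by blast
  next
    case False
    with that As have "1\<^sub>m (d * d) \<in> set Bs" by (metis set_ConsD)
    then obtain c where c: "?B = c \<cdot>\<^sub>m 1\<^sub>m (d * d)" using IH by blast
    obtain a where a: "\<And>x x'. \<lbrakk>x < d; x' < d\<rbrakk> \<Longrightarrow>
        (\<Sum>y<d. A $$ (x * d + y, x' * d + y)) = (if x = x' then a else 0)"
      using A unfolding balanced_def by blast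
    from glue_scalar_right[OF balanced_carrier_mat[OF A] a, of c] show ?thesis unfolding c by blast
  qed
  then show ?case using balanced_glue[OF A] IH step by simp
qed

text \<open>In other words, \<open>ancilla d k\<close> is an isometry.\<close>

lemma contract_one: "contract d k (replicate (Suc k) (1\<^sub>m (d * d))) = 1\<^sub>m (d * d)" if "d > 0"
proof (induction k)
  case 0
  show ?case by (simp add: contract_singleton)
next
  case (Suc k)
  have "contract d (Suc k) (1\<^sub>m (d * d) # replicate (Suc k) (1\<^sub>m (d * d)))
      = glue d (1\<^sub>m (d * d)) (contract d k (replicate (Suc k) (1\<^sub>m (d * d))))"
    by (rule contract_Cons) (simp_all only: kron_list_one one_carrier_mat)
  then show ?case using Suc glue_one_one[OF that] by simp
qed

section \<open>Unitary error bases\<close>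

lemma ueb_map_carrier_mat [simp]: "ueb_map d U \<in> carrier_mat (d * d) (d * d)"
  by (simp add: ueb_map_def power2_eq_square)

lemma dim_ueb_map [simp]: "dim_row (ueb_map d U) = d * d" "dim_col (ueb_map d U) = d * d"
  by (simp_all add: ueb_map_def power2_eq_square)

lemma index_ueb_map:
  "ueb_map d U $$ (s, x * d + y) = complex_of_real (1 / sqrt d) * U s $$ (x, y)"
  if "s < d * d" "x < d" "y < d"
  using that by (simp add: ueb_map_def power2_eq_square mult_add_less)

lemma ueb_carrier_mat: "U s \<in> carrier_mat d d" if "unitary_error_basis d U" "s < d * d"
  using that by (auto simp: unitary_error_basis_def unitary_group_def power2_eq_square)

text \<open>The rows of \<open>ueb_map d U\<close> are the flattened matrices \<open>U s\<close>
  divided by the square root of \<open>d\<close>, so trace orthogonality says that the rows are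
  orthonormal. For a square matrix this gives the other unitarity equation.\<close>

lemma ueb_map_unitary:
  assumes U: "unitary_error_basis d U" and d: "d > 0"
  shows "dagger (ueb_map d U) * ueb_map d U = 1\<^sub>m (d * d)"
proof -
  let ?V = "ueb_map d U"
  have V': "dagger ?V \<in> carrier_mat (d * d) (d * d)" by (intro carrier_matI) simp_all
  have "?V * dagger ?V = 1\<^sub>m (d * d)"
  proof (rule eq_matI)
    fix s t assume "s < dim_row (1\<^sub>m (d * d) :: complex mat)" "t < dim_col (1\<^sub>m (d * d) :: complex mat)"
    then have st: "s < d * d" "t < d * d" by simp_all
    note Us = ueb_carrier_mat[OF U st(1)] and Ut = ueb_carrier_mat[OF U st(2)]
    have "(?V * dagger ?V) $$ (s, t) = (\<Sum>x<d. \<Sum>y<d. ?V $$ (s, x * d + y) * cnj (?V $$ (t, x * d + y)))"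
      using st by (subst index_mult_mat_sum) (simp_all add: sum_lessThan_mult index_dagger mult_add_less)
    also have "\<dots> = (\<Sum>x<d. \<Sum>y<d. (complex_of_real (1 / sqrt d) * complex_of_real (1 / sqrt d)) *
        (cnj (U t $$ (x, y)) * U s $$ (x, y)))"
      by (intro sum.cong refl) (simp only: lessThan_iff index_ueb_map st,
        simp only: complex_cnj_mult complex_cnj_complex_of_real mult_ac)
    also have "\<dots> = 1 / of_nat d * (\<Sum>x<d. \<Sum>y<d. cnj (U t $$ (x, y)) * U s $$ (x, y))"
      by (simp only: of_real_inverse_sqrt_square sum_distrib_left)
    \<comment> \<open>The Hilbert-Schmidt inner product; swapping the sums puts the diagonal index
      of the trace outermost.\<close>
    also have "(\<Sum>x<d. \<Sum>y<d. cnj (U t $$ (x, y)) * U s $$ (x, y)) = mat_trace (dagger (U t) * U s)"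
      using Us Ut by (subst sum.swap)
        (simp add: mat_trace_def index_mult_mat_sum index_dagger del: index_mult_mat(1))
    also have "\<dots> = (if t = s then of_nat d else 0)"
      using U st by (simp add: unitary_error_basis_def power2_eq_square)
    finally show "(?V * dagger ?V) $$ (s, t) = 1\<^sub>m (d * d) $$ (s, t)" using st d by simp
  qed simp_all
  then show ?thesis by (rule mat_mult_left_right_inverse[OF ueb_map_carrier_mat V'])
qed

text \<open>A diagonal \<open>C\<close> turns the conjugate into a linear combination, over
  \<open>s\<close>, of rank-one operators built from the flattened \<open>U s\<close>. The partial
  traces of each such term are the products of \<open>U s\<close> and its adjoint in the two orders,
  up to transposition and the factor \<open>1 / of_nat d\<close>, and hence scalar.\<close>

lemma balanced_ueb_conjugate:
  assumes U: "unitary_error_basis d U"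
    and C: "C \<in> carrier_mat (d * d) (d * d)"
    and diag: "\<And>s t. \<lbrakk>s < d * d; t < d * d; s \<noteq> t\<rbrakk> \<Longrightarrow> C $$ (s, t) = 0"
  shows "balanced d (dagger (ueb_map d U) * C * ueb_map d U)"
proof -
  let ?V = "ueb_map d U"
  define A where "A = dagger ?V * C * ?V"
  have A: "A \<in> carrier_mat (d * d) (d * d)"
    unfolding A_def by (intro carrier_matI) simp_all
  have conj: "A $$ (x * d + y, x' * d + y') = 1 / of_nat d *
      (\<Sum>s<d * d. C $$ (s, s) * (cnj (U s $$ (x, y)) * U s $$ (x', y')))"
    if x: "x < d" "y < d" "x' < d" "y' < d" for x y x' y'
  proof -
    have "A $$ (x * d + y, x' * d + y')
        = (\<Sum>s<d * d. \<Sum>t<d * d. cnj (?V $$ (s, x * d + y)) * C $$ (s, t) * ?V $$ (t, x' * d + y'))"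
      unfolding A_def using x C by (subst index_conjugate) (auto simp: mult_add_less)
    also have "\<dots> = (\<Sum>s<d * d. \<Sum>t<d * d. if s = t then
        cnj (?V $$ (s, x * d + y)) * C $$ (s, s) * ?V $$ (s, x' * d + y') else 0)"
      by (intro sum.cong refl) (auto simp: diag)
    also have "\<dots> = (\<Sum>s<d * d. cnj (?V $$ (s, x * d + y)) * C $$ (s, s) * ?V $$ (s, x' * d + y'))"
      by simp
    also have "\<dots> = (\<Sum>s<d * d. (complex_of_real (1 / sqrt d) * complex_of_real (1 / sqrt d)) *
        (C $$ (s, s) * (cnj (U s $$ (x, y)) * U s $$ (x', y'))))"
      by (intro sum.cong refl) (simp only: lessThan_iff index_ueb_map x,
        simp only: complex_cnj_mult complex_cnj_complex_of_real mult_ac)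
    finally show ?thesis by (simp only: of_real_inverse_sqrt_square sum_distrib_left)
  qed
  have rows: "(\<Sum>y<d. cnj (U s $$ (x, y)) * U s $$ (x', y)) = (if x = x' then 1 else 0)"
    and cols: "(\<Sum>y<d. cnj (U s $$ (y, x)) * U s $$ (y, x')) = (if x = x' then 1 else 0)"
    if s: "s < d * d" and x: "x < d" "x' < d" for s x x'
  proof -
    have Us: "U s \<in> carrier_mat d d" "U s * dagger (U s) = 1\<^sub>m d" "dagger (U s) * U s = 1\<^sub>m d"
      using U s by (auto simp: unitary_error_basis_def unitary_group_def power2_eq_square)
    show "(\<Sum>y<d. cnj (U s $$ (x, y)) * U s $$ (x', y)) = (if x = x' then 1 else 0)"
      \<comment> \<open>The entry is taken at \<open>(x', x)\<close>, since the adjoint stands on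
        the right and the conjugated factor carries the column index.\<close>
      using arg_cong[OF Us(2), of "\<lambda>M. M $$ (x', x)"] Us(1) x
      by (auto simp: index_mult_mat_sum index_dagger mult.commute simp del: index_mult_mat(1))
    show "(\<Sum>y<d. cnj (U s $$ (y, x)) * U s $$ (y, x')) = (if x = x' then 1 else 0)"
      using arg_cong[OF Us(3), of "\<lambda>M. M $$ (x, x')"] Us(1) x
      by (auto simp: index_mult_mat_sum index_dagger simp del: index_mult_mat(1))
  qed
  \<comment> \<open>The normalized trace of \<open>C\<close> is the scalar for both partial
    traces.\<close>
  define a where "a = 1 / of_nat d * (\<Sum>s<d * d. C $$ (s, s))"
  have "(\<Sum>y<d. A $$ (x * d + y, x' * d + y)) = (if x = x' then a else 0)" if x: "x < d" "x' < d" for x x'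
  proof -
    have "(\<Sum>y<d. A $$ (x * d + y, x' * d + y)) = 1 / of_nat d *
        (\<Sum>y<d. \<Sum>s<d * d. C $$ (s, s) * (cnj (U s $$ (x, y)) * U s $$ (x', y)))"
      using x by (simp add: conj sum_distrib_left)
    also have "\<dots> = 1 / of_nat d * (\<Sum>s<d * d. C $$ (s, s) * (\<Sum>y<d. cnj (U s $$ (x, y)) * U s $$ (x', y)))"
      by (subst sum.swap) (simp only: sum_distrib_left)
    finally show ?thesis using x by (simp add: rows a_def)
  qed
  moreover have "(\<Sum>y<d. A $$ (y * d + x, y * d + x')) = (if x = x' then a else 0)" if x: "x < d" "x' < d" for x x'
  proof -
    have "(\<Sum>y<d. A $$ (y * d + x, y * d + x')) = 1 / of_nat d *
        (\<Sum>y<d. \<Sum>s<d * d. C $$ (s, s) * (cnj (U s $$ (y, x)) * U s $$ (y, x')))"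
      using x by (simp add: conj sum_distrib_left)
    also have "\<dots> = 1 / of_nat d * (\<Sum>s<d * d. C $$ (s, s) * (\<Sum>y<d. cnj (U s $$ (y, x)) * U s $$ (y, x')))"
      by (subst sum.swap) (simp only: sum_distrib_left)
    finally show ?thesis using x by (simp add: cols a_def)
  qed
  ultimately show ?thesis using A unfolding A_def[symmetric] balanced_def by blast
qed

section \<open>One block of the code\<close>

definition encoder :: "nat \<Rightarrow> nat \<Rightarrow> (nat \<Rightarrow> complex mat) \<Rightarrow> complex mat" where
  "encoder d n U = copy_map n (d\<^sup>2) * ueb_map d U"

lemma encoder_carrier_mat [simp]: "encoder d n U \<in> carrier_mat ((d * d) ^ n) (d * d)"
  unfolding encoder_def power2_eq_square by (rule mult_carrier_mat[OF copy_map_carrier_mat ueb_map_carrier_mat])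

lemma dim_encoder [simp]:
  "dim_row (encoder d n U) = (d * d) ^ n" "dim_col (encoder d n U) = d * d"
  using carrier_matD[OF encoder_carrier_mat[of d n U]] by simp_all

lemma dagger_carrier_mat: "dagger A \<in> carrier_mat b a" if "A \<in> carrier_mat a b"
  using that by (intro carrier_matI) auto

text \<open>Conjugation by the copy map produces the entrywise product \<open>C\<close> of the
  factors. One identity factor kills all off-diagonal entries, so
  \<open>balanced_ueb_conjugate\<close> applies; if all factors are the identity then
  \<open>C\<close> is the identity as well, and unitarity of \<open>ueb_map d U\<close>
  finishes.\<close>

lemma encoder_conjugate:
  assumes len: "length Ws = n" and Ws: "set Ws \<subseteq> carrier_mat (d * d) (d * d)"
    and one: "1\<^sub>m (d * d) \<in> set Ws" and U: "unitary_error_basis d U" and d: "d > 0"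
  defines "A \<equiv> dagger (encoder d n U) * kron_list Ws * encoder d n U"
  shows "balanced d A" and "set Ws = {1\<^sub>m (d * d)} \<Longrightarrow> A = 1\<^sub>m (d * d)"
proof -
  let ?\<Delta> = "copy_map n (d * d)" and ?V = "ueb_map d U" and ?K = "kron_list Ws"
  define C where "C = dagger ?\<Delta> * ?K * ?\<Delta>"
  have K: "?K \<in> carrier_mat ((d * d) ^ n) ((d * d) ^ n)"
    using kron_list_carrier_mat[of Ws id "d * d" "d * d"] Ws len by auto
  have "A = (dagger ?V * dagger ?\<Delta>) * ?K * (?\<Delta> * ?V)"
    unfolding A_def encoder_def power2_eq_square
    by (subst dagger_mult) simp_all
  also have "\<dots> = dagger ?V * C * ?V"
    unfolding C_def
    by (rule mult_mat_regroup[OF dagger_carrier_mat dagger_carrier_mat K])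
      (rule ueb_map_carrier_mat copy_map_carrier_mat)+
  finally have A: "A = dagger ?V * C * ?V" .
  have C: "C \<in> carrier_mat (d * d) (d * d)"
    unfolding C_def by (intro carrier_matI) simp_all
  have index: "C $$ (s, t) = (\<Prod>W\<leftarrow>Ws. W $$ (s, t))" if "s < d * d" "t < d * d" for s t
    unfolding C_def using index_copy_map_conjugate[OF Ws that] by (simp add: len)
  have diag: "C $$ (s, t) = 0" if st: "s < d * d" "t < d * d" "s \<noteq> t" for s t
  proof -
    have "0 \<in> set (map (\<lambda>W. W $$ (s, t)) Ws)" using one st by force
    then show ?thesis using st by (simp add: index prod_list_zero_iff)
  qed
  show "balanced d A" unfolding A by (rule balanced_ueb_conjugate[OF U C diag])
  show "A = 1\<^sub>m (d * d)" if all: "set Ws = {1\<^sub>m (d * d)}"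
  proof -
    have "C $$ (s, s) = 1" if s: "s < d * d" for s
    proof -
      have "map (\<lambda>W. W $$ (s, s)) Ws = map (\<lambda>W. 1) Ws"
        using all s by (intro map_cong refl) auto
      then show ?thesis using s by (simp add: index map_replicate_const)
    qed
    then have "C = 1\<^sub>m (d * d)" using C diag by (intro eq_matI) auto
    then show ?thesis
      unfolding A using ueb_map_unitary[OF U d] by (simp add: right_mult_one_mat')
  qed
qed

section \<open>The code isometry as a chain of blocks\<close>

lemma code_isometry_carrier_mat:
  "code_isometry d (Suc k) U \<in> carrier_mat ((d\<^sup>2) ^ (Suc k)\<^sup>2) (d\<^sup>2)"
proof -
  have "kron_list (map (\<lambda>m. encoder d (Suc k) (U m)) [0..<Suc k])
      \<in> carrier_mat (((d * d) ^ Suc k) ^ Suc k) ((d * d) ^ Suc k)"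
    using kron_list_carrier_mat[of "[0..<Suc k]" "\<lambda>m. encoder d (Suc k) (U m)", OF encoder_carrier_mat]
    by (simp only: length_upt diff_zero)
  then show ?thesis
    unfolding code_isometry_def encoder_def[symmetric] ancilla_def[symmetric] diff_Suc_1
    unfolding power2_eq_square power_mult
    by (rule mult_carrier_mat[OF _ ancilla_carrier_mat])
qed

text \<open>The outer layer of the code is a tensor product of encoders, so conjugation by it acts
  on each block of \<open>n\<close> physical factors separately; the inner layer is
  \<open>ancilla d k\<close> and contracts the \<open>n\<close> resulting operators.\<close>

lemma code_isometry_conjugate:
  assumes n: "n = Suc k" and len: "length Ws = n * n" and Ws: "set Ws \<subseteq> carrier_mat (d * d) (d * d)"
  shows "dagger (code_isometry d n U) * kron_list Ws * code_isometry d n U = contract d k (map (\<lambda>m.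
    dagger (encoder d n (U m)) * kron_list (map (\<lambda>j. Ws ! (m * n + j)) [0..<n]) * encoder d n (U m)) [0..<n])"
proof -
  define T where "T m = encoder d n (U m)" for m
  define K where "K m = kron_list (map (\<lambda>j. Ws ! (m * n + j)) [0..<n])" for m
  let ?T = "kron_list (map T [0..<n])" and ?E = "ancilla d k"
  have T: "?T \<in> carrier_mat (((d * d) ^ n) ^ n) ((d * d) ^ n)"
    using kron_list_carrier_mat[of "[0..<n]" T] by (simp add: T_def)
  have E: "?E \<in> carrier_mat ((d * d) ^ n) (d * d)" unfolding n by (rule ancilla_carrier_mat)
  have K: "K m \<in> carrier_mat ((d * d) ^ n) ((d * d) ^ n)" if "m < n" for m
  proof -
    have "Ws ! (m * n + j) \<in> carrier_mat (d * d) (d * d)" if "j < n" for j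
      using Ws len mult_add_less[OF \<open>m < n\<close> that] by (metis nth_mem subsetD)
    then show ?thesis unfolding K_def using kron_list_carrier_mat[of "[0..<n]" "\<lambda>j. Ws ! (m * n + j)"] by simp
  qed
  have "kron_list Ws = kron_list (map (\<lambda>i. Ws ! i) [0..<n * n])" by (simp add: map_nth flip: len)
  then have blocks: "kron_list Ws = kron_list (map K [0..<n])"
    by (simp add: kron_list_blocks K_def[abs_def])
  have W: "kron_list Ws \<in> carrier_mat (((d * d) ^ n) ^ n) (((d * d) ^ n) ^ n)"
    unfolding blocks using kron_list_carrier_mat[of "[0..<n]" K] K by simp
  have "code_isometry d n U = ?T * ?E"
    by (simp add: code_isometry_def T_def[abs_def] encoder_def ancilla_def n del: upt_Suc)
  then have "dagger (code_isometry d n U) * kron_list Ws * code_isometry d n U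
      = (dagger ?E * dagger ?T) * kron_list Ws * (?T * ?E)"
    using carrier_matD[OF T] carrier_matD[OF E] by (simp only: dagger_mult)
  also have "\<dots> = dagger ?E * (dagger ?T * kron_list Ws * ?T) * ?E"
    by (rule mult_mat_regroup[OF dagger_carrier_mat[OF E] dagger_carrier_mat[OF T] W T E])
  also have "dagger ?T * kron_list Ws * ?T = kron_list (map (\<lambda>m. dagger (T m) * K m) [0..<n]) * ?T"
    unfolding blocks dagger_kron_list map_map comp_def
    by (subst kron_list_mult) (use carrier_matD[OF K] in \<open>auto simp: T_def\<close>)
  also have "\<dots> = kron_list (map (\<lambda>m. dagger (T m) * K m * T m) [0..<n])"
    by (subst kron_list_mult) (use carrier_matD[OF K] in \<open>auto simp: T_def\<close>)
  finally show ?thesis by (simp add: contract_def T_def K_def)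
qed

text \<open>
  Pigeonhole: fewer than \<open>n\<close> errors leave one of the \<open>n\<close> blocks untouched and hit
  no block in all of its \<open>n\<close> positions.
\<close>

lemma few_errors_blocks:
  fixes n :: nat
  assumes "card {i. i < n * n \<and> P i} < n"
  shows "\<exists>m<n. \<forall>j<n. \<not> P (m * n + j)" and "m < n \<Longrightarrow> \<exists>j<n. \<not> P (m * n + j)"
proof -
  let ?S = "{i. i < n * n \<and> P i}"
  have fin: "finite ?S" by simp
  show "\<exists>m<n. \<forall>j<n. \<not> P (m * n + j)"
  proof (rule ccontr)
    assume "\<not> ?thesis"
    then have hit: "\<exists>j<n. P (m * n + j)" if "m < n" for m using that by blast
    \<comment> \<open>\<open>i div n\<close> is the block of position \<open>i\<close>. If every
      block were hit, this map would send the errors onto all \<open>n\<close> blocks.\<close>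
    have "m \<in> (\<lambda>i. i div n) ` ?S" if "m < n" for m
    proof -
      obtain j where "j < n" "P (m * n + j)" using hit[OF \<open>m < n\<close>] by blast
      then show ?thesis using that by (intro image_eqI[of _ _ "m * n + j"]) (auto simp: mult_add_less)
    qed
    then have "{..<n} \<subseteq> (\<lambda>i. i div n) ` ?S" by blast
    then have "n \<le> card ?S" using fin surj_card_le[of ?S "{..<n}"] by simp
    then show False using assms by simp
  qed
  show "\<exists>j<n. \<not> P (m * n + j)" if m: "m < n"
  proof (rule ccontr)
    assume "\<not> ?thesis"
    \<comment> \<open>A block hit everywhere would contribute \<open>n\<close> distinct error
      positions.\<close>
    then have "(\<lambda>j. m * n + j) ` {..<n} \<subseteq> ?S" using m by (auto simp: mult_add_less)
    then have "card ((\<lambda>j. m * n + j) ` {..<n}) \<le> card ?S" by (rule card_mono[OF fin])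
    then show False using assms by (simp add: card_image inj_on_def)
  qed
qed

section \<open>Isometry and Knill-Laflamme condition\<close>

theorem mainTheorem10:
  fixes d n :: nat and U :: "nat \<Rightarrow> nat \<Rightarrow> complex mat"
  assumes "d \<ge> 1" and "n \<ge> 1"
    and "\<And>m. m < n \<Longrightarrow> unitary_error_basis d (U m)"
  shows "is_code (d\<^sup>2) (n\<^sup>2) 1 n (unitary_group (d\<^sup>2)) (code_isometry d n U)"
proof -
  obtain k where n: "n = Suc k" using \<open>n \<ge> 1\<close> by (cases n) auto
  have d: "d > 0" using \<open>d \<ge> 1\<close> by simp
  let ?i = "code_isometry d n U" and ?I = "1\<^sub>m (d * d) :: complex mat"
  let ?block = "\<lambda>Ws m. map (\<lambda>j. Ws ! (m * n + j)) [0..<n]"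
  let ?A = "\<lambda>Ws m. dagger (encoder d n (U m)) * kron_list (?block Ws m) * encoder d n (U m)"
  have i: "?i \<in> carrier_mat ((d\<^sup>2) ^ n\<^sup>2) (d\<^sup>2)"
    using code_isometry_carrier_mat[of d k U] by (simp add: n)
  \<comment> \<open>The conjugation formula is applied to the error-free word: each block yields the
    identity, and so does their contraction.\<close>
  have "dagger ?i * ?i = 1\<^sub>m (d\<^sup>2)"
  proof -
    let ?Ws = "replicate (n * n) ?I"
    have "?A ?Ws m = ?I" if m: "m < n" for m
    proof -
      have "?Ws ! (m * n + j) = ?I" if "j < n" for j
        using mult_add_less[OF m that] by simp
      \<comment> \<open>Since \<open>n\<close> is positive the block is nonempty, so its set of
        factors is exactly the singleton.\<close>
      then have all: "set (?block ?Ws m) = {?I}" using n by (auto simp: image_iff)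
      have "set (?block ?Ws m) \<subseteq> carrier_mat (d * d) (d * d)" "?I \<in> set (?block ?Ws m)"
        unfolding all by simp_all
      then show ?thesis using encoder_conjugate(2)[OF _ _ _ assms(3)[OF m] d all] by simp
    qed
    then have "map (?A ?Ws) [0..<n] = replicate (Suc k) ?I"
      by (intro nth_equalityI) (simp_all add: n del: upt_Suc replicate_Suc)
    moreover have "set ?Ws \<subseteq> carrier_mat (d * d) (d * d)" by auto
    ultimately have "dagger ?i * kron_list ?Ws * ?i = ?I"
      using code_isometry_conjugate[OF n length_replicate, of _ d U] contract_one[OF d, of k] by simp
    moreover have "kron_list ?Ws = 1\<^sub>m ((d\<^sup>2) ^ n\<^sup>2)" by (simp only: kron_list_one power2_eq_square)
    ultimately show ?thesis
      using i by (simp add: right_mult_one_mat' power2_eq_square)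
  qed
  moreover have "\<exists>c. dagger ?i * e * ?i = c \<cdot>\<^sub>m 1\<^sub>m (d\<^sup>2)"
    if e: "local_operator (d\<^sup>2) (n\<^sup>2) n (unitary_group (d\<^sup>2)) e" for e
  proof -
    obtain Ws where len: "length Ws = n * n" and unitary: "set Ws \<subseteq> unitary_group (d\<^sup>2)"
      and few: "card {i. i < n * n \<and> Ws ! i \<noteq> ?I} < n" and e: "e = kron_list Ws"
      using e unfolding local_operator_def power2_eq_square by blast
    have Ws: "set Ws \<subseteq> carrier_mat (d * d) (d * d)"
      using unitary by (auto simp: unitary_group_def power2_eq_square)
    have block: "set (?block Ws m) \<subseteq> carrier_mat (d * d) (d * d)" if "m < n" for m
      using Ws len mult_add_less[OF that, of _ n] by (fastforce simp: subset_iff)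
    have balanced: "balanced d (?A Ws m)" if m: "m < n" for m
    proof (rule encoder_conjugate(1)[OF _ block[OF m] _ assms(3)[OF m] d])
      \<comment> \<open>Fewer than \<open>n\<close> errors cannot fill block \<open>m\<close>, so an
        identity factor remains to make it diagonal after copying.\<close>
      obtain j where "j < n" "Ws ! (m * n + j) = ?I" using few_errors_blocks(2)[OF few m] by blast
      then show "?I \<in> set (?block Ws m)" by force
    qed simp
    \<comment> \<open>The block without any error supplies the identity link that makes the whole
      chain scalar.\<close>
    obtain m where m: "m < n" and clean: "\<And>j. j < n \<Longrightarrow> Ws ! (m * n + j) = ?I"
      using few_errors_blocks(1)[OF few] by blast
    have "set (?block Ws m) = {?I}" using clean n by (auto simp: image_iff)
    then have clean_block: "?A Ws m = ?I"
      using encoder_conjugate(2)[OF _ block[OF m] _ assms(3)[OF m] d] by simp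
    have "?I \<in> set (map (?A Ws) [0..<n])"
      unfolding set_map by (rule image_eqI[where x = m]) (simp_all add: clean_block m)
    moreover have "length (map (?A Ws) [0..<n]) = Suc k" using n by simp
    moreover have "\<And>A. A \<in> set (map (?A Ws) [0..<n]) \<Longrightarrow> balanced d A" using balanced by auto
    ultimately obtain c where "contract d k (map (?A Ws) [0..<n]) = c \<cdot>\<^sub>m ?I"
      using contract_balanced by blast
    then show ?thesis
      unfolding e code_isometry_conjugate[OF n len Ws] power2_eq_square by blast
  qed
  ultimately show ?thesis using i by (simp add: is_code_def)
qed

end
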